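(* Let $n\in\mathbb{N}$, $\delta\in(0,1)$ and $m = n(1-\delta)$. In any open-addressing scheme without reordering that inserts $m$ keys $k_1,\dots,k_m$ into an array of $n$ slots, the worst-case expected probe complexity is $\Omega(\log \delta^{-1})$. In particular, there exists some $i \in [m]$ with $\mathbb{E}[Y_i] = \Omega(\log \delta^{-1})$, where $Y_i$ is the probe complexity of $k_i$ and the implied constant is absolute.
   Context: An open-addressing scheme without reordering with capacity $n$: an array of $n$ slots indexed by $[n]$, initially empty; keys $k_1,\dots,k_m$ are inserted one after another; each key $k_i$ has an infinite probe sequence $H_1(k_i),H_2(k_i),\dots\in[n]^\infty$, and these probe sequences are i.i.d. across keys. To insert $k_i$, an (arbitrary, not necessarily greedy) insertion algorithm places $k_i$ into some currently unoccupied slot $H_j(k_i)$; placed elements are never moved. The probe complexity of $k_i$ is $Y_i$, the index $j$ such that $k_i$ is placed in slot $H_{j}(k_i)$. The worst-case expected probe complexity is $\max_i \mathbb{E}[Y_i]$. $\log$ is base 2. *)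

theory Defs
  imports "HOL-Probability.Probability"
begin

text \<open>
  Slots are \<open>{1..n}\<close>, keys are \<open>{1..m}\<close>, and probe positions are the positive naturals.
  A probe sequence is an (extensional) function from \<open>{1..}\<close> to \<open>{1..n}\<close>.
\<close>

definition probe_seqs :: "nat \<Rightarrow> (nat \<Rightarrow> nat) measure" where
  "probe_seqs n = PiM {1..} (\<lambda>_. count_space {1..n})"

text \<open>
  An insertion algorithm \<open>A i r h\<close> returns the probe position used for key \<open>i\<close>, where \<open>h\<close> holds
  the probe sequences of keys \<open>1, ..., i\<close> only and \<open>r\<close> is a random seed. Together these determine
  the current table contents. Outcomes are pairs of a seed, distributed by \<open>S\<close>, and a family of
  independent probe sequences, each distributed by \<open>P\<close> and independent of the seed. The seed is a
  real number rather than an element of an arbitrary type, so that a constant chosen before \<open>S\<close>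
  cannot depend on a type variable; a real seed can encode countably many real random choices.
\<close>

type_synonym insertion_alg = "nat \<Rightarrow> real \<Rightarrow> (nat \<Rightarrow> nat \<Rightarrow> nat) \<Rightarrow> nat"
type_synonym outcome = "real \<times> (nat \<Rightarrow> nat \<Rightarrow> nat)"

definition outcomes :: "nat \<Rightarrow> (nat \<Rightarrow> nat) measure \<Rightarrow> real measure \<Rightarrow> outcome measure" where
  "outcomes m P S = S \<Otimes>\<^sub>M PiM {1..m} (\<lambda>_. P)"

definition probe_complexity :: "insertion_alg \<Rightarrow> nat \<Rightarrow> outcome \<Rightarrow> nat" where
  "probe_complexity A i \<omega> = A i (fst \<omega>) (restrict (snd \<omega>) {1..i})"

definition slot :: "insertion_alg \<Rightarrow> nat \<Rightarrow> outcome \<Rightarrow> nat" where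
  "slot A i \<omega> = snd \<omega> i (probe_complexity A i \<omega>)"

text \<open>
  Elements never move, so the slots occupied when key \<open>i\<close> arrives are exactly the slots
  of keys \<open>1, ..., i - 1\<close>.
\<close>

locale open_addressing_scheme =
  fixes n m :: nat
    and P :: "(nat \<Rightarrow> nat) measure"
    and S :: "real measure"
    and A :: insertion_alg
  assumes prob_space_P: "prob_space P"
    and sets_P: "sets P = sets (probe_seqs n)"
    and prob_space_S: "prob_space S"
    and measurable_alg: "\<And>i. i \<in> {1..m} \<Longrightarrow>
      (\<lambda>(r, h). A i r h) \<in> measurable (S \<Otimes>\<^sub>M PiM {1..i} (\<lambda>_. P)) (count_space UNIV)"
    and placement: "AE \<omega> in outcomes m P S. \<forall>i\<in>{1..m}.
      1 \<le> probe_complexity A i \<omega> \<and> slot A i \<omega> \<notin> (\<lambda>j. slot A j \<omega>) ` {1..<i}"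

text \<open>Expectations are extended nonnegative reals, so an infinite expectation has the value \<open>\<infinity>\<close>.\<close>

definition expected_probe_complexity ::
    "nat \<Rightarrow> (nat \<Rightarrow> nat) measure \<Rightarrow> real measure \<Rightarrow> insertion_alg \<Rightarrow> nat \<Rightarrow> ennreal" where
  "expected_probe_complexity m P S A i =
     (\<integral>\<^sup>+ \<omega>. of_nat (probe_complexity A i \<omega>) \<partial>outcomes m P S)"

definition worst_case_expected_probe_complexity ::
    "nat \<Rightarrow> (nat \<Rightarrow> nat) measure \<Rightarrow> real measure \<Rightarrow> insertion_alg \<Rightarrow> ennreal" where
  "worst_case_expected_probe_complexity m P S A =
     Max (expected_probe_complexity m P S A ` {1..m})"

end

theory Submission imports Defs begin

text \<open>
  Let \<open>T\<close> be twice the largest expected probe complexity, and give each slot as weight the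
  probability that a key probes it within its first \<open>T\<close> probes; the weights sum to at most \<open>T\<close>.
  When key \<open>i\<close> arrives, exactly \<open>f = n + 1 - i\<close> slots are free, and they are independent of the
  probe sequence of key \<open>i\<close>. So with probability at most \<open>1/4\<close> one of its first \<open>T\<close> probes
  hits a free slot of weight at most \<open>1/(4f)\<close>. By Markov's inequality, key \<open>i\<close> uses at most \<open>T\<close>
  probes with probability at least \<open>1/2\<close>, hence with probability at least \<open>1/4\<close> it is placed in
  a slot of weight more than \<open>1/(4f)\<close>. Slots are used at most once, so summing the expected
  weights of the used slots gives \<open>T \<ge> (\<Sum>i\<le>m. 1/(n + 1 - i)) / 16\<close>, which is of order
  \<open>ln (n/(n - m)) = ln (1/\<delta>)\<close>.
\<close>

section \<open>Measurability, independence and distinctness of the used slots\<close>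

context open_addressing_scheme
begin

lemma prob_space_outcomes: "prob_space (outcomes m P S)"
  unfolding outcomes_def
  by (intro prob_space_pair prob_space_PiM prob_space_P prob_space_S)

lemma space_P: "space P = {1..} \<rightarrow>\<^sub>E {1..n}"
  using sets_eq_imp_space_eq[OF sets_P] by (simp add: probe_seqs_def space_PiM)

lemma probe_in_slots:
  assumes "\<omega> \<in> space (outcomes m P S)" "i \<in> {1..m}" "1 \<le> k"
  shows "snd \<omega> i k \<in> {1..n}"
proof -
  have "snd \<omega> i \<in> space P"
    using assms by (auto simp: outcomes_def space_pair_measure space_PiM)
  then have "snd \<omega> i k \<in> {1..n}"
    unfolding space_P by (rule PiE_mem) (use assms(3) in simp)
  then show ?thesis .
qed

lemma measurable_probe [measurable]:
  "(\<lambda>h. h k) \<in> measurable P (count_space UNIV)"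
proof (cases "1 \<le> k")
  case True
  then have "(\<lambda>h. h k) \<in> measurable (probe_seqs n) (count_space {1..n})"
    unfolding probe_seqs_def by (intro measurable_component_singleton) auto
  then have "(\<lambda>h. h k) \<in> measurable P (count_space {1..n})"
    using measurable_cong_sets[OF sets_P refl] by blast
  then show ?thesis
    by (rule measurable_compose) simp
next
  case False
  \<comment> \<open>Position 0 lies outside the index set, so by extensionality this coordinate is
    constant. The case is needed because \<open>measurable_slot\<close> ranges over all natural
    numbers as probe positions.\<close>
  have "h k = undefined" if "h \<in> space P" for h
    using that[unfolded space_P] by (rule PiE_arb) (use False in simp)
  then show ?thesis
    by (subst measurable_cong[where g = "\<lambda>h. undefined"]) simp_all
qed

lemma measurable_probe_seq:
  assumes "i \<in> {1..m}"
  shows "(\<lambda>\<omega>. snd \<omega> i) \<in> measurable (outcomes m P S) P"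
  using assms unfolding outcomes_def
  by (intro measurable_compose[OF measurable_snd] measurable_component_singleton)

lemma measurable_probe_complexity:
  assumes "i \<in> {1..m}"
  shows "probe_complexity A i \<in> measurable (outcomes m P S) (count_space UNIV)"
proof -
  have "(\<lambda>\<omega>. restrict (snd \<omega>) {1..i}) \<in> measurable (outcomes m P S) (PiM {1..i} (\<lambda>_. P))"
    unfolding outcomes_def using assms
    by (intro measurable_compose[OF measurable_snd] measurable_restrict_subset) auto
  moreover have "fst \<in> measurable (outcomes m P S) S"
    unfolding outcomes_def by simp
  ultimately have "(\<lambda>\<omega>. (fst \<omega>, restrict (snd \<omega>) {1..i}))
      \<in> measurable (outcomes m P S) (S \<Otimes>\<^sub>M PiM {1..i} (\<lambda>_. P))"
    by simp
  from measurable_compose[OF this measurable_alg[OF assms]] show ?thesis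
    by (simp add: probe_complexity_def[abs_def])
qed

text \<open>The slot is a probe read at a random position. That position takes countably many
  values, so measurability at each fixed position suffices.\<close>

lemma measurable_slot:
  assumes "i \<in> {1..m}"
  shows "slot A i \<in> measurable (outcomes m P S) (count_space UNIV)"
  unfolding slot_def[abs_def]
  by (rule measurable_compose_countable[OF _ measurable_probe_complexity[OF assms]])
     (rule measurable_compose[OF measurable_probe_seq[OF assms] measurable_probe])

text \<open>An insertion sees only the probe sequences up to its own key. This is what makes the
  slots occupied before key \<open>i\<close> independent of the probe sequence of key
  \<open>i\<close>.\<close>

lemma slot_update_later_key:
  assumes "j < i"
  shows "slot A j (r, h(i := y)) = slot A j (r, h)"
proof -
  have "restrict (h(i := y)) {1..j} = restrict h {1..j}"
    using assms by (auto simp: restrict_def)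
  then show ?thesis using assms by (simp add: slot_def probe_complexity_def)
qed

text \<open>Fubini: for a fixed seed, integrate coordinate \<open>i\<close> separately from the
  others; \<open>g\<close> ignores that coordinate and factors out. Independence is thus used in the
  form of invariance under updates, with no generated sigma-algebras.\<close>

lemma nn_integral_probe_seq_indep:
  fixes g :: "outcome \<Rightarrow> ennreal"
  assumes i: "i \<in> {1..m}"
    and g: "g \<in> borel_measurable (outcomes m P S)"
    and B: "B \<in> sets P"
    and indep: "\<And>r h y. g (r, h(i := y)) = g (r, h)"
  shows "(\<integral>\<^sup>+\<omega>. g \<omega> * indicator B (snd \<omega> i) \<partial>outcomes m P S) =
         (\<integral>\<^sup>+\<omega>. g \<omega> \<partial>outcomes m P S) * emeasure P B"
proof -
  interpret P: prob_space P by (rule prob_space_P)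
  let ?K = "PiM {1..m} (\<lambda>_. P)"
  interpret K: prob_space ?K by (intro prob_space_PiM prob_space_P)
  interpret PP: product_sigma_finite "\<lambda>_. P" by unfold_locales
  note g' [measurable] = g[unfolded outcomes_def]
  note B [measurable]
  have comp [measurable]: "(\<lambda>\<omega>. \<omega> i) \<in> measurable ?K P"
    using i by (rule measurable_component_singleton)
  have ins: "insert i ({1..m} - {i}) = {1..m}" using i by auto
  have *: "(\<integral>\<^sup>+h. g (r, h) * indicator B (h i) \<partial>?K) = (\<integral>\<^sup>+h. g (r, h) \<partial>?K) * emeasure P B"
    if r: "r \<in> space S" for r
  proof -
    have m1: "(\<lambda>h. g (r, h)) \<in> borel_measurable ?K"
      using r by measurable
    have m2: "(\<lambda>h. g (r, h) * indicator B (h i)) \<in> borel_measurable ?K"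
      using m1 by measurable
    have "(\<integral>\<^sup>+h. g (r, h) * indicator B (h i) \<partial>?K) =
        (\<integral>\<^sup>+x. (\<integral>\<^sup>+y. g (r, x) * indicator B y \<partial>P) \<partial>PiM ({1..m} - {i}) (\<lambda>_. P))"
      using PP.product_nn_integral_insert[of "{1..m} - {i}" i "\<lambda>h. g (r, h) * indicator B (h i)"] m2
      unfolding ins by (simp add: indep)
    also have "\<dots> = (\<integral>\<^sup>+x. g (r, x) * emeasure P B \<partial>PiM ({1..m} - {i}) (\<lambda>_. P))"
      by (simp add: nn_integral_cmult_indicator)
    \<comment> \<open>Since \<open>P\<close> has mass 1, a dummy integration over coordinate
      \<open>i\<close> changes nothing and restores the integral over all keys. The invariance of
      \<open>g\<close> holds for every \<open>h\<close>, in particular for \<open>x\<close>, which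
      has no coordinate \<open>i\<close> yet.\<close>
    also have "\<dots> = (\<integral>\<^sup>+x. (\<integral>\<^sup>+y. g (r, x(i := y)) * emeasure P B \<partial>P) \<partial>PiM ({1..m} - {i}) (\<lambda>_. P))"
      by (simp add: indep P.emeasure_space_1)
    also have "\<dots> = (\<integral>\<^sup>+h. g (r, h) * emeasure P B \<partial>?K)"
      using PP.product_nn_integral_insert[of "{1..m} - {i}" i "\<lambda>h. g (r, h) * emeasure P B"] m1
      unfolding ins by simp
    also have "\<dots> = (\<integral>\<^sup>+h. g (r, h) \<partial>?K) * emeasure P B"
      using m1 by (rule nn_integral_multc)
    finally show ?thesis .
  qed
  have m3: "(\<lambda>\<omega>. g \<omega> * indicator B (snd \<omega> i)) \<in> borel_measurable (S \<Otimes>\<^sub>M ?K)"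
    by measurable
  have "(\<integral>\<^sup>+\<omega>. g \<omega> * indicator B (snd \<omega> i) \<partial>outcomes m P S) =
      (\<integral>\<^sup>+r. (\<integral>\<^sup>+h. g (r, h) * indicator B (h i) \<partial>?K) \<partial>S)"
    unfolding outcomes_def using K.nn_integral_fst[OF m3] by simp
  also have "\<dots> = (\<integral>\<^sup>+r. (\<integral>\<^sup>+h. g (r, h) \<partial>?K) * emeasure P B \<partial>S)"
    by (intro nn_integral_cong *)
  also have "\<dots> = (\<integral>\<^sup>+r. (\<integral>\<^sup>+h. g (r, h) \<partial>?K) \<partial>S) * emeasure P B"
    by (intro nn_integral_multc) measurable
  also have "\<dots> = (\<integral>\<^sup>+\<omega>. g \<omega> \<partial>outcomes m P S) * emeasure P B"
    unfolding outcomes_def using K.nn_integral_fst[OF g'] by simp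
  finally show ?thesis .
qed

lemma AE_distinct_slots:
  "AE \<omega> in outcomes m P S.
    inj_on (\<lambda>j. slot A j \<omega>) {1..m} \<and> (\<lambda>j. slot A j \<omega>) ` {1..m} \<subseteq> {1..n}"
  using placement AE_space
proof eventually_elim
  case (elim \<omega>)
  have "slot A j \<omega> \<noteq> slot A k \<omega>" if "j \<in> {1..m}" "k \<in> {1..m}" "j < k" for j k
  proof -
    have "j \<in> {1..<k}" using that by simp
    then have "slot A j \<omega> \<in> (\<lambda>j. slot A j \<omega>) ` {1..<k}" by (rule imageI)
    then show ?thesis using bspec[OF elim(1) that(2)] by metis
  qed
  then have "inj_on (\<lambda>j. slot A j \<omega>) {1..m}"
    unfolding inj_on_def by (metis linorder_neqE_nat)
  moreover have "slot A j \<omega> \<in> {1..n}" if "j \<in> {1..m}" for j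
    using probe_in_slots[OF elim(2) that] elim(1) that by (simp add: slot_def)
  ultimately show ?case by blast
qed

section \<open>Slot weights and the bound for a single key\<close>

definition hits :: "nat \<Rightarrow> nat \<Rightarrow> (nat \<Rightarrow> nat) set" where
  "hits T s = {h \<in> space P. \<exists>j\<in>{1..T}. h j = s}"

lemma sets_hits [measurable]: "hits T s \<in> sets P"
  unfolding hits_def by measurable

text \<open>For a fixed probe sequence, the indicators count the distinct slots among its first
  \<open>T\<close> probes, of which there are at most \<open>T\<close>. Taking expectations gives
  the bound on the total weight.\<close>

lemma sum_hits_le: "(\<Sum>s\<in>{1..n}. emeasure P (hits T s)) \<le> of_nat T"
proof -
  interpret P: prob_space P by (rule prob_space_P)
  have "(\<Sum>s\<in>{1..n}. emeasure P (hits T s)) =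
      (\<integral>\<^sup>+h. (\<Sum>s\<in>{1..n}. indicator (hits T s) h) \<partial>P)"
    by (subst nn_integral_sum) simp_all
  also have "\<dots> \<le> (\<integral>\<^sup>+h. of_nat T \<partial>P)"
  proof (intro nn_integral_mono)
    fix h
    have "(\<Sum>s\<in>{1..n}. indicator (hits T s) h :: ennreal) = of_nat (card {s\<in>{1..n}. h \<in> hits T s})"
      by (simp add: indicator_def sum.If_cases Int_def)
    moreover have "card {s\<in>{1..n}. h \<in> hits T s} \<le> card (h ` {1..T})"
      by (intro card_mono) (auto simp: hits_def)
    then have "card {s\<in>{1..n}. h \<in> hits T s} \<le> T"
      using card_image_le[of "{1..T}" h] by simp
    ultimately show "(\<Sum>s\<in>{1..n}. indicator (hits T s) h :: ennreal) \<le> of_nat T"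
      by (simp only: of_nat_le_iff)
  qed
  also have "\<dots> = of_nat T" by (simp add: P.emeasure_space_1)
  finally show ?thesis .
qed

text \<open>Late placement contributes at most 1/2 and light slots at most 1/4 to a union bound of
  total at least 1. The remaining 1/4 must come from \<open>4 * f\<close> times the expected weight,
  which gives the constant 16.\<close>

lemma expected_weight_of_slot:
  assumes i: "i \<in> {1..m}" and mn: "m \<le> n" and T: "0 < T"
    and M: "expected_probe_complexity m P S A i \<le> ennreal (real T / 2)"
  shows "ennreal (1 / (16 * real (n + 1 - i)))
      \<le> (\<integral>\<^sup>+\<omega>. emeasure P (hits T (slot A i \<omega>)) \<partial>outcomes m P S)"
proof -
  interpret \<Omega>: prob_space "outcomes m P S" by (rule prob_space_outcomes)
  define f where "f = real (n + 1 - i)"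
  have f: "f > 0" using i mn by (auto simp: f_def)
  define w where "w s = emeasure P (hits T s)" for s
  define L where "L = {s \<in> {1..n}. w s \<le> ennreal (1 / (4 * f))}"
  define free :: "nat \<Rightarrow> outcome \<Rightarrow> ennreal" where
    "free s \<omega> = (if \<exists>j\<in>{1..<i}. slot A j \<omega> = s then 0 else 1)" for s \<omega>
  have [measurable]: "slot A j \<in> measurable (outcomes m P S) (count_space UNIV)"
    if "j \<in> {1..<i}" for j using that i by (intro measurable_slot) auto
  have [measurable]: "slot A i \<in> measurable (outcomes m P S) (count_space UNIV)"
    "probe_complexity A i \<in> measurable (outcomes m P S) (count_space UNIV)"
    "(\<lambda>\<omega>. snd \<omega> i) \<in> measurable (outcomes m P S) P"
    using i by (intro measurable_slot measurable_probe_complexity measurable_probe_seq; simp)+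
  have free_meas [measurable]: "free s \<in> borel_measurable (outcomes m P S)" for s
    unfolding free_def[abs_def] by measurable
  have w_meas [measurable]: "(\<lambda>\<omega>. w (slot A i \<omega>)) \<in> borel_measurable (outcomes m P S)"
    by measurable
  let ?late = "\<lambda>\<omega>. of_nat (probe_complexity A i \<omega>) * ennreal (1 / real T)"
  let ?light = "\<lambda>\<omega>. \<Sum>s\<in>L. free s \<omega> * indicator (hits T s) (snd \<omega> i)"
  let ?heavy = "\<lambda>\<omega>. ennreal (4 * f) * w (slot A i \<omega>)"
  \<comment> \<open>A union bound in expectation form, with Markov's inequality built into \<open>?late\<close>.\<close>
  have "AE \<omega> in outcomes m P S. 1 \<le> ?late \<omega> + ?light \<omega> + ?heavy \<omega>"
    using placement AE_space
  proof eventually_elim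
    case (elim \<omega>)
    let ?k = "probe_complexity A i \<omega>" and ?s = "slot A i \<omega>"
    have k: "1 \<le> ?k" using bspec[OF elim(1) i] by blast
    have s_free: "\<not> (\<exists>j\<in>{1..<i}. slot A j \<omega> = ?s)"
      using bspec[OF elim(1) i] unfolding image_iff by metis
    have s_in: "?s \<in> {1..n}"
      using probe_in_slots[OF elim(2) i k] by (simp add: slot_def)
    \<comment> \<open>In each case one summand alone is at least 1: \<open>?late\<close>,
      \<open>?heavy\<close> and \<open>?light\<close> respectively.\<close>
    consider "T < ?k" | "w ?s > ennreal (1 / (4 * f))" | "?k \<le> T" "?s \<in> L"
      using s_in by (force simp: L_def)
    then show ?case
    proof cases
      case 1
      have "ennreal 1 \<le> ennreal (real ?k * (1 / real T))"
        using 1 T by (intro ennreal_leI) simp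
      also have "\<dots> = ?late \<omega>"
        by (subst ennreal_mult) (simp_all add: ennreal_of_nat_eq_real_of_nat)
      finally show ?thesis by (simp add: add_increasing2)
    next
      case 2
      have "1 = ennreal (4 * f * (1 / (4 * f)))" using f by simp
      also have "\<dots> = ennreal (4 * f) * ennreal (1 / (4 * f))"
        using f by (subst ennreal_mult) simp_all
      also have "\<dots> \<le> ?heavy \<omega>" using 2 by (intro mult_left_mono) auto
      finally show ?thesis by (simp add: add_increasing)
    next
      case 3
      have "snd \<omega> i \<in> space P"
        using elim(2) i by (auto simp: outcomes_def space_pair_measure space_PiM)
      then have "snd \<omega> i \<in> hits T ?s"
        using 3 k by (auto simp: hits_def slot_def intro!: bexI[of _ ?k])
      then have "1 = free ?s \<omega> * indicator (hits T ?s) (snd \<omega> i)"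
        using s_free by (simp add: free_def)
      also have "\<dots> \<le> ?light \<omega>"
        using 3 by (intro member_le_sum) (auto simp: L_def)
      finally show ?thesis by (simp add: add_increasing add_increasing2)
    qed
  qed
  then have "(\<integral>\<^sup>+\<omega>. 1 \<partial>outcomes m P S)
      \<le> (\<integral>\<^sup>+\<omega>. ?late \<omega> + ?light \<omega> + ?heavy \<omega> \<partial>outcomes m P S)"
    by (rule nn_integral_mono_AE)
  then have total: "1 \<le> (\<integral>\<^sup>+\<omega>. ?late \<omega> \<partial>outcomes m P S)
      + (\<integral>\<^sup>+\<omega>. ?light \<omega> \<partial>outcomes m P S) + (\<integral>\<^sup>+\<omega>. ?heavy \<omega> \<partial>outcomes m P S)"
    by (simp add: nn_integral_add \<Omega>.emeasure_space_1)
  have late: "(\<integral>\<^sup>+\<omega>. ?late \<omega> \<partial>outcomes m P S) \<le> ennreal (1/2)"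
  proof -
    have "(\<integral>\<^sup>+\<omega>. ?late \<omega> \<partial>outcomes m P S)
        = expected_probe_complexity m P S A i * ennreal (1 / real T)"
      unfolding expected_probe_complexity_def by (rule nn_integral_multc) measurable
    also have "\<dots> \<le> ennreal (real T / 2) * ennreal (1 / real T)"
      using M by (rule mult_right_mono) simp
    also have "\<dots> = ennreal (1/2)"
      using T by (subst ennreal_mult[symmetric]) simp_all
    finally show ?thesis .
  qed
  have light: "(\<integral>\<^sup>+\<omega>. ?light \<omega> \<partial>outcomes m P S) \<le> ennreal (1/4)"
  proof -
    have "(\<integral>\<^sup>+\<omega>. ?light \<omega> \<partial>outcomes m P S)
        = (\<Sum>s\<in>L. \<integral>\<^sup>+\<omega>. free s \<omega> * indicator (hits T s) (snd \<omega> i) \<partial>outcomes m P S)"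
      by (rule nn_integral_sum) measurable
    \<comment> \<open>Being free is decided by the keys before \<open>i\<close>, so it is
      independent of whether key \<open>i\<close> probes \<open>s\<close>. Each light slot then
      costs at most \<open>1 / (4 * f)\<close>, and the expected number of free light slots is at
      most \<open>f\<close>.\<close>
    also have "\<dots> = (\<Sum>s\<in>L. (\<integral>\<^sup>+\<omega>. free s \<omega> \<partial>outcomes m P S) * w s)"
      unfolding w_def
      by (intro sum.cong refl nn_integral_probe_seq_indep i free_meas sets_hits)
         (simp add: free_def slot_update_later_key)
    also have "\<dots> \<le> (\<Sum>s\<in>L. (\<integral>\<^sup>+\<omega>. free s \<omega> \<partial>outcomes m P S) * ennreal (1 / (4 * f)))"
      by (intro sum_mono mult_left_mono) (auto simp: L_def)
    also have "\<dots> = (\<integral>\<^sup>+\<omega>. (\<Sum>s\<in>L. free s \<omega>) \<partial>outcomes m P S) * ennreal (1 / (4 * f))"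
      by (simp add: nn_integral_sum sum_distrib_right)
    also have "\<dots> \<le> (\<integral>\<^sup>+\<omega>. ennreal f \<partial>outcomes m P S) * ennreal (1 / (4 * f))"
    proof (intro mult_right_mono nn_integral_mono_AE)
      show "AE \<omega> in outcomes m P S. (\<Sum>s\<in>L. free s \<omega>) \<le> ennreal f"
        using AE_distinct_slots
      proof eventually_elim
        case (elim \<omega>)
        let ?occ = "(\<lambda>j. slot A j \<omega>) ` {1..<i}"
        have sub: "{1..<i} \<subseteq> {1..m}" using i by auto
        have occ: "?occ \<subseteq> {1..n}"
          using order_trans[OF image_mono[OF sub] conjunct2[OF elim]] .
        have card_occ: "card ?occ = i - 1"
          using card_image[OF inj_on_subset[OF conjunct1[OF elim] sub]] by simp
        have "(\<Sum>s\<in>L. free s \<omega>) \<le> (\<Sum>s\<in>{1..n}. free s \<omega>)"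
          by (intro sum_mono2) (auto simp: L_def)
        also have "\<dots> = (\<Sum>s\<in>{1..n} - ?occ. 1)"
          by (rule sum.mono_neutral_cong_right) (auto simp: free_def)
        also have "\<dots> = of_nat (card ({1..n} - ?occ))" by simp
        \<comment> \<open>Key \<open>i\<close> arrives after \<open>i - 1\<close> keys, all in
          distinct slots, leaving \<open>n - (i - 1)\<close> slots free.\<close>
        also have "card ({1..n} - ?occ) = n + 1 - i"
          using occ card_occ i mn by (subst card_Diff_subset) auto
        finally show ?case by (simp add: f_def ennreal_of_nat_eq_real_of_nat)
      qed
    qed simp
    also have "\<dots> = ennreal (1/4)"
      using f by (simp add: \<Omega>.emeasure_space_1 ennreal_mult[symmetric])
    finally show ?thesis .
  qed
  have heavy: "(\<integral>\<^sup>+\<omega>. ?heavy \<omega> \<partial>outcomes m P S)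
      = ennreal (4 * f) * (\<integral>\<^sup>+\<omega>. w (slot A i \<omega>) \<partial>outcomes m P S)"
    by (rule nn_integral_cmult) measurable
  have "ennreal (1/2) + ennreal (1/4) = ennreal (3/4)"
    by (subst ennreal_plus[symmetric]) simp_all
  then have *: "1 \<le> ennreal (3/4) + ennreal (4 * f) * (\<integral>\<^sup>+\<omega>. w (slot A i \<omega>) \<partial>outcomes m P S)"
    using order_trans[OF total add_mono[OF add_mono[OF late light] order_refl]] unfolding heavy by simp
  have "ennreal (1 / (16 * f)) \<le> (\<integral>\<^sup>+\<omega>. w (slot A i \<omega>) \<partial>outcomes m P S)"
  proof (cases "\<integral>\<^sup>+\<omega>. w (slot A i \<omega>) \<partial>outcomes m P S")
    case (real x)
    have "ennreal 1 \<le> ennreal (3/4 + 4 * f * x)"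
      using * f real by (simp add: ennreal_mult)
    then have "1 \<le> 3/4 + 4 * f * x"
      using f real by (subst (asm) ennreal_le_iff) auto
    then show ?thesis
      using f real by (auto intro!: ennreal_leI simp: field_simps)
  qed simp
  then show ?thesis by (simp add: w_def f_def)
qed

text \<open>Almost surely the keys occupy distinct slots, so the weights of the used slots form a
  subsum of the weights of all slots, at most \<open>T\<close>. The per-key lower bounds on the
  expected weights must fit into this budget.\<close>

lemma sum_inverse_free_slots_le:
  assumes mn: "m \<le> n" and T: "0 < T"
    and M: "\<And>i. i \<in> {1..m} \<Longrightarrow> expected_probe_complexity m P S A i \<le> ennreal (real T / 2)"
  shows "(\<Sum>i\<in>{1..m}. 1 / real (n + 1 - i)) \<le> 16 * real T"
proof -
  interpret \<Omega>: prob_space "outcomes m P S" by (rule prob_space_outcomes)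
  have "ennreal (\<Sum>i\<in>{1..m}. 1 / (16 * real (n + 1 - i)))
      = (\<Sum>i\<in>{1..m}. ennreal (1 / (16 * real (n + 1 - i))))"
    by (rule sum_ennreal[symmetric]) simp
  also have "\<dots> \<le> (\<Sum>i\<in>{1..m}. \<integral>\<^sup>+\<omega>. emeasure P (hits T (slot A i \<omega>)) \<partial>outcomes m P S)"
    by (intro sum_mono expected_weight_of_slot assms)
  also have "\<dots> = (\<integral>\<^sup>+\<omega>. (\<Sum>i\<in>{1..m}. emeasure P (hits T (slot A i \<omega>))) \<partial>outcomes m P S)"
    by (rule nn_integral_sum[symmetric]) (rule measurable_compose[OF measurable_slot], simp_all)
  also have "\<dots> \<le> (\<integral>\<^sup>+\<omega>. of_nat T \<partial>outcomes m P S)"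
  proof (rule nn_integral_mono_AE)
    show "AE \<omega> in outcomes m P S. (\<Sum>i\<in>{1..m}. emeasure P (hits T (slot A i \<omega>))) \<le> of_nat T"
      using AE_distinct_slots
    proof eventually_elim
      case (elim \<omega>)
      have "(\<Sum>i\<in>{1..m}. emeasure P (hits T (slot A i \<omega>)))
          = (\<Sum>s\<in>(\<lambda>j. slot A j \<omega>) ` {1..m}. emeasure P (hits T s))"
        using elim by (simp add: sum.reindex)
      also have "\<dots> \<le> (\<Sum>s\<in>{1..n}. emeasure P (hits T s))"
        using elim by (intro sum_mono2) auto
      finally show ?case using sum_hits_le order_trans by blast
    qed
  qed
  also have "\<dots> = ennreal (real T)"
    by (simp add: \<Omega>.emeasure_space_1 ennreal_of_nat_eq_real_of_nat)
  finally have "(\<Sum>i\<in>{1..m}. 1 / (16 * real (n + 1 - i))) \<le> real T"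
    by (subst (asm) ennreal_le_iff) auto
  moreover have "(\<Sum>i\<in>{1..m}. 1 / (16 * real (n + 1 - i))) = (\<Sum>i\<in>{1..m}. 1 / real (n + 1 - i)) / 16"
    by (simp add: sum_divide_distrib mult.commute)
  ultimately show ?thesis by simp
qed

text \<open>This allows twice the worst case to be rounded up to an integer at the cost of a
  constant factor only.\<close>

lemma one_le_expected_probe_complexity:
  assumes "i \<in> {1..m}"
  shows "1 \<le> expected_probe_complexity m P S A i"
proof -
  interpret \<Omega>: prob_space "outcomes m P S" by (rule prob_space_outcomes)
  have "AE \<omega> in outcomes m P S. (1 :: ennreal) \<le> of_nat (probe_complexity A i \<omega>)"
    using placement
  proof eventually_elim
    case (elim \<omega>)
    then have "of_nat 1 \<le> (of_nat (probe_complexity A i \<omega>) :: ennreal)"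
      using assms by (subst of_nat_le_iff) auto
    then show ?case by simp
  qed
  then have "(\<integral>\<^sup>+\<omega>. 1 \<partial>outcomes m P S) \<le> expected_probe_complexity m P S A i"
    unfolding expected_probe_complexity_def by (rule nn_integral_mono_AE)
  then show ?thesis by (simp add: \<Omega>.emeasure_space_1)
qed

end

section \<open>The harmonic sum and the final constant\<close>

lemma ln_le_sum_inverse:
  assumes "m < n"
  shows "ln (real n / real (n - m)) \<le> 2 * (\<Sum>i\<in>{1..m}. 1 / real (n + 1 - i))"
  using assms
proof (induction m)
  case (Suc m)
  define d where "d = real (n - Suc m)"
  have d: "d \<ge> 1" "real (n - m) = d + 1" using Suc.prems by (auto simp: d_def)
  have "ln (real n / d) = ln (real n / (d + 1)) + ln (1 + 1 / d)"
  proof -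
    have "real n / d = real n / (d + 1) * (1 + 1 / d)" using d by (simp add: divide_simps)
    then have "ln (real n / d) = ln (real n / (d + 1) * (1 + 1 / d))" by (rule arg_cong)
    also have "\<dots> = ln (real n / (d + 1)) + ln (1 + 1 / d)"
      using d Suc.prems by (intro ln_mult_pos) (auto intro: add_pos_nonneg)
    finally show ?thesis .
  qed
  moreover have "ln (1 + 1 / d) \<le> 1 / d"
    using d by (intro ln_add_one_self_le_self) simp
  \<comment> \<open>The new summand is \<open>1 / (d + 1)\<close> while the logarithm grows by up to
    \<open>1 / d\<close>; the factor 2 absorbs this shift because \<open>d >= 1\<close>.\<close>
  moreover have "1 / d \<le> 2 / (d + 1)" using d by (simp add: field_simps)
  moreover have "real (n + 1 - Suc m) = d + 1" using d by simp
  ultimately show ?case using Suc d by (simp add: d_def[symmetric] algebra_simps)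
qed simp

theorem theorem5:
  "\<exists>c::real. c > 0 \<and>
     (\<forall>(n::nat) (m::nat) (\<delta>::real) P S A.
        n \<ge> 1 \<longrightarrow> 0 < \<delta> \<longrightarrow> \<delta> < 1 \<longrightarrow> real m = real n * (1 - \<delta>) \<longrightarrow>
        open_addressing_scheme n m P S A \<longrightarrow>
          worst_case_expected_probe_complexity m P S A \<ge> ennreal (c * log 2 (1 / \<delta>)) \<and>
          (\<exists>i\<in>{1..m}. expected_probe_complexity m P S A i \<ge> ennreal (c * log 2 (1 / \<delta>))))"
\<comment> \<open>Here 96 = 2 * 16 * 3: the factor 2 is from \<open>ln_le_sum_inverse\<close>, 16
  from \<open>sum_inverse_free_slots_le\<close>, and 3 from rounding \<open>2 * M\<close> up to
  \<open>T\<close>. The factor \<open>ln 2\<close> converts the base-2 logarithm to the natural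
  one.\<close>
proof (intro exI[of _ "ln 2 / 96"] conjI allI impI)
  fix n m :: nat and \<delta> :: real and P S A
  assume n: "n \<ge> 1" and \<delta>: "0 < \<delta>" "\<delta> < 1" and m: "real m = real n * (1 - \<delta>)"
    and scheme: "open_addressing_scheme n m P S A"
  interpret open_addressing_scheme n m P S A by (rule scheme)
  let ?E = "expected_probe_complexity m P S A"
  let ?W = "worst_case_expected_probe_complexity m P S A"
  \<comment> \<open>There is at least one key because \<open>\<delta> < 1\<close>, so the maximum is
    attained; \<open>\<delta> > 0\<close> gives \<open>m < n\<close>, so \<open>n - m\<close> is a
    positive denominator.\<close>
  have "real m > 0" using n \<delta> by (simp add: m)
  moreover have "real m < real n" using n \<delta> by (simp add: m)
  ultimately have mn: "0 < m" "m < n" by simp_all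
  have "?W \<in> ?E ` {1..m}"
    unfolding worst_case_expected_probe_complexity_def using mn by (intro Max_in) auto
  then obtain i where i: "i \<in> {1..m}" "?W = ?E i" by blast
  have E_le: "?E j \<le> ?W" if "j \<in> {1..m}" for j
    unfolding worst_case_expected_probe_complexity_def using that by (intro Max_ge) auto
  have nm: "real (n - m) = real n * \<delta>" using mn m by (simp add: of_nat_diff algebra_simps)
  have "ennreal (ln 2 / 96 * log 2 (1 / \<delta>)) \<le> ?W"
  proof (cases ?W)
    case (real M)
    have "ennreal 1 \<le> ennreal M"
      using one_le_expected_probe_complexity[OF i(1)] i(2) real by simp
    then have M: "1 \<le> M" using real by (subst (asm) ennreal_le_iff) auto
    \<comment> \<open>An integer is needed to count probes. Markov's inequality asks for
      \<open>T >= 2 * M\<close>, and \<open>M >= 1\<close> bounds the ceiling by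
      \<open>2 * M + 1 <= 3 * M\<close>.\<close>
    define T where "T = nat \<lceil>2 * M\<rceil>"
    have T: "2 * M \<le> real T" "real T \<le> 3 * M" using M unfolding T_def by linarith+
    have "ln (1 / \<delta>) = ln (real n / real (n - m))" using n \<delta> by (simp add: nm)
    also have "\<dots> \<le> 2 * (\<Sum>i\<in>{1..m}. 1 / real (n + 1 - i))"
      using mn(2) by (rule ln_le_sum_inverse)
    also have "(\<Sum>i\<in>{1..m}. 1 / real (n + 1 - i)) \<le> 16 * real T"
    proof (rule sum_inverse_free_slots_le)
      fix j assume "j \<in> {1..m}"
      then have "?E j \<le> ennreal M" using E_le real by metis
      also have "\<dots> \<le> ennreal (real T / 2)" using T by (intro ennreal_leI) simp
      finally show "?E j \<le> ennreal (real T / 2)" .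
    qed (use mn M T in auto)
    finally have "ln (1 / \<delta>) / 96 \<le> M" using T by simp
    then show ?thesis using real by (auto simp: log_def intro!: ennreal_leI)
  qed simp
  then show "ennreal (ln 2 / 96 * log 2 (1 / \<delta>)) \<le> ?W"
    and "\<exists>i\<in>{1..m}. ennreal (ln 2 / 96 * log 2 (1 / \<delta>)) \<le> ?E i"
    using i by auto
qed simp

end
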